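(* Let $d\in\mathbb{N}$, let $E_j\subset\mathbb{C}$, $j=1,\ldots,d$, be compact sets, and define $E:=E_1\times\cdots\times E_d\subset\mathbb{C}^d$. Then \[ t_{\mathbb{Z}}(E)\le\min_{1\le j\le d}t_{\mathbb{Z}}(E_j). \] If $t_{\mathbb{C}}(E_j)\ge 1$ for all $j=1,\ldots,d$, then for every $n\in\mathbb{N}_0$ the constant polynomial $C_n(z)\equiv 1$ is an integer Chebyshev polynomial of degree $n$ for $E$, and $t_{\mathbb{Z}}(E)=1$.
   Context: $\mathbb{N}_0=\mathbb{N}\cup\{0\}$. $\mathcal{P}_n^d(\mathbb{Z})$ is the set of polynomials $\sum_{|k|\le n}a_kz^k$ in $d$ complex variables of (total) degree at most $n$ with integer coefficients, where $k\in\mathbb{N}_0^d$, $|k|=\sum_i k_i$, $z^k=z_1^{k_1}\cdots z_d^{k_d}$. For compact $E\subset\mathbb{C}^d$, $\|f\|_E:=\sup_{z\in E}|f(z)|$. A (multivariate) integer Chebyshev polynomial of degree $n$ for $E$ is a polynomial $C_n\in\mathcal{P}_n^d(\mathbb{Z})$, $C_n\not\equiv0$, with $\|C_n\|_E=t_{\mathbb{Z}}(n,E):=\inf\{\|P\|_E:P\in\mathcal{P}_n^d(\mathbb{Z}),\ P\not\equiv0\}$ (the actual degree of $C_n$ may be less than $n$). The integer Chebyshev constant is $t_{\mathbb{Z}}(E):=\lim_{n\to\infty}t_{\mathbb{Z}}(n,E)^{1/n}$; for the planar sets $E_j\subset\mathbb{C}$ this is the same definition with $d=1$. For compact $K\subset\mathbb{C}$,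 $t_{\mathbb{C}}(K)$ is the classical Chebyshev constant, $t_{\mathbb{C}}(K):=\lim_{n\to\infty}\left(\inf\|p\|_K\right)^{1/n}$, where the infimum is over all monic polynomials $p$ of degree $n$ in one variable with complex coefficients; it equals the logarithmic capacity of $K$ and the transfinite diameter of $K$. *)

theory Defs
  imports
    "HOL-Analysis.Analysis"
    "HOL-Library.Poly_Mapping"
    "HOL-Computational_Algebra.Polynomial"
begin

text \<open>
  Points of complex \<open>d\<close>-space are vectors of type \<open>complex ^ 'd\<close> with \<open>CARD('d) = d\<close>.
  A polynomial in the variables \<open>'d\<close> with integer coefficients is a finitely supported map
  from multi-indices \<open>'d \<Rightarrow>\<^sub>0 nat\<close> to \<open>int\<close>; with the instances of
  \<^theory>\<open>HOL-Library.Poly_Mapping\<close> these form the polynomial ring, whose \<open>0\<close> and \<open>1\<close> are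
  the constant polynomials.
\<close>

type_synonym 'd int_mpoly = "('d \<Rightarrow>\<^sub>0 nat) \<Rightarrow>\<^sub>0 int"

definition multi_index_size :: "('d::finite \<Rightarrow>\<^sub>0 nat) \<Rightarrow> nat" where
  "multi_index_size k = (\<Sum>i\<in>UNIV. Poly_Mapping.lookup k i)"

definition int_mpolys :: "nat \<Rightarrow> ('d::finite) int_mpoly set" where
  "int_mpolys n = {P. \<forall>k\<in>Poly_Mapping.keys P. multi_index_size k \<le> n}"

definition eval_mpoly :: "('d::finite) int_mpoly \<Rightarrow> complex ^ 'd \<Rightarrow> complex" where
  "eval_mpoly P z =
     (\<Sum>k\<in>Poly_Mapping.keys P. of_int (Poly_Mapping.lookup P k) *
        (\<Prod>i\<in>UNIV. (z $ i) ^ Poly_Mapping.lookup k i))"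

text \<open>
  The supremum is taken in \<open>[0, \<infinity>)\<close>: inserting \<open>0\<close> changes nothing for nonempty \<open>E\<close>
  and makes the norm over the empty set \<open>0\<close> rather than unspecified.
\<close>

definition sup_norm :: "'a set \<Rightarrow> ('a \<Rightarrow> complex) \<Rightarrow> real" where
  "sup_norm E f = Sup (insert 0 ((\<lambda>z. norm (f z)) ` E))"

definition int_cheb_value :: "nat \<Rightarrow> (complex ^ 'd::finite) set \<Rightarrow> real" where
  "int_cheb_value n E =
     Inf ((\<lambda>P. sup_norm E (eval_mpoly P)) ` {P \<in> int_mpolys n. P \<noteq> 0})"

definition is_int_cheb_poly ::
    "nat \<Rightarrow> (complex ^ 'd::finite) set \<Rightarrow> 'd int_mpoly \<Rightarrow> bool" where
  "is_int_cheb_poly n E C \<longleftrightarrow>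
     C \<in> int_mpolys n \<and> C \<noteq> 0 \<and> sup_norm E (eval_mpoly C) = int_cheb_value n E"

definition int_cheb_const :: "(complex ^ 'd::finite) set \<Rightarrow> real" where
  "int_cheb_const E = lim (\<lambda>n. root n (int_cheb_value n E))"

text \<open>A planar set is identified with a set in complex \<open>1\<close>-space.\<close>

definition int_cheb_const_planar :: "complex set \<Rightarrow> real" where
  "int_cheb_const_planar K = int_cheb_const {z :: complex ^ 1. z $ 1 \<in> K}"

definition cheb_const :: "complex set \<Rightarrow> real" where
  "cheb_const K =
     lim (\<lambda>n. root n (Inf ((\<lambda>p. sup_norm K (poly p)) `
       {p :: complex poly. degree p = n \<and> lead_coeff p = 1})))"

end

theory Submission
  imports Defs "HOL-Computational_Algebra.Fundamental_Theorem_Algebra"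
begin

text \<open>
  A nonzero integer polynomial in one variable can be read as a polynomial in the \<open>j\<close>-th of
  \<open>d\<close> variables; its norm over the product set is at most its norm over the \<open>j\<close>-th factor.
  Hence the minimal norm of every degree is no larger for the product, which gives the inequality
  once the \<open>n\<close>-th roots of the minimal norms are known to converge. They converge because
  minimal norms are submultiplicative in the degree (\<open>submult_root_tendsto\<close>, in the manner
  of Fekete). Submultiplicativity needs that a product of nonzero polynomials is nonzero, which
  is seen by restricting both factors to a complex line (\<open>int_mpoly_mult_nonzero\<close>).

  For the second part, Fekete's argument also says that the limit is a lower bound of the
  sequence. So a compact planar set with Chebyshev constant at least 1 carries no monic polynomial
  of norm less than 1, that is, every complex polynomial takes there a value at least as
  large in modulus as its leading coefficient (\<open>dominates_lead_coeff_compact\<close>). On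
  a product of such sets this allows the variables to be fixed one after the other: a polynomial
  in \<open>z\<^sub>1, \<dots>, z\<^sub>d\<close> is at a suitable \<open>z\<^sub>d\<close> at least as large as its
  leading coefficient with respect to \<open>z\<^sub>d\<close>, which is again a polynomial in the remaining
  variables whose coefficients are among the original ones. After all variables are used up, one
  nonzero integer is left (\<open>exists_norm_ge_1_on_product\<close>). Hence no nonzero integer
  polynomial has norm less than 1, and the constant 1 is optimal in every degree.
\<close>

section \<open>Roots of submultiplicative sequences\<close>

lemma submult_div_mod_bound:
  fixes u :: "nat \<Rightarrow> real"
  assumes nonneg: "\<And>n. 0 \<le> u n"
    and submult: "\<And>m n. u (m + n) \<le> u m * u n"
  shows "u (q * m + s) \<le> u m ^ q * u s"
proof (induction q)
  case (Suc q)
  have "u (Suc q * m + s) \<le> u m * u (q * m + s)"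
    using submult[of m "q * m + s"] by (simp add: add.assoc)
  also have "\<dots> \<le> u m * (u m ^ q * u s)"
    using Suc.IH nonneg by (rule mult_left_mono)
  finally show ?case
    by (simp add: mult.assoc)
qed simp

text \<open>
  This is Fekete's lemma in multiplicative form; the limit is the infimum of the roots. If
  \<open>root m (u m) < r\<close> for one \<open>m\<close>, then division of \<open>n\<close> by \<open>m\<close> with remainder gives
  \<open>u n \<le> C * r ^ n\<close> with \<open>C\<close> independent of \<open>n\<close>, and \<open>root n C\<close> tends to 1. Working with
  roots instead of logarithms lets \<open>u\<close> vanish, as the least norm of monic
  polynomials over a finite set does in large degrees.
\<close>

lemma submult_root_tendsto:
  fixes u :: "nat \<Rightarrow> real"
  assumes nonneg: "\<And>n. 0 \<le> u n"
    and submult: "\<And>m n. u (m + n) \<le> u m * u n"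
  obtains L where "(\<lambda>n. root n (u n)) \<longlonglongrightarrow> L" "\<And>n. 0 < n \<Longrightarrow> L \<le> root n (u n)"
proof
  define L where "L = (INF n\<in>{0<..}. root n (u n))"
  have bdd: "bdd_below ((\<lambda>n. root n (u n)) ` {0<..})"
    by (rule bdd_belowI[of _ 0]) (auto intro: nonneg)
  show lower: "L \<le> root n (u n)" if "0 < n" for n
    unfolding L_def using bdd that by (intro cINF_lower) auto
  have L_nonneg: "0 \<le> L"
    unfolding L_def by (intro cINF_greatest) (auto intro: nonneg)
  have upper: "\<forall>\<^sub>F n in sequentially. root n (u n) < y" if "L < y" for y
  proof -
    obtain r where r: "L < r" "r < y"
      using \<open>L < y\<close> dense by blast
    then have "0 < r"
      using L_nonneg by simp
    obtain m where m: "0 < m" "root m (u m) < r"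
      using r(1) bdd unfolding L_def by (subst (asm) cINF_less_iff) auto
    have um: "u m \<le> r ^ m"
    proof -
      have "u m = root m (u m) ^ m"
        using m nonneg by simp
      also have "\<dots> \<le> r ^ m"
        using m nonneg by (intro power_mono) auto
      finally show ?thesis .
    qed
    \<comment> \<open>The sum bounds each of the finitely many remainder terms; the summand 1 keeps
      the constant positive, so that its roots tend to 1.\<close>
    define C where "C = 1 + (\<Sum>s<m. u s / r ^ s)"
    have "1 \<le> C"
      unfolding C_def using nonneg \<open>0 < r\<close> by (simp add: sum_nonneg)
    have bound: "u n \<le> C * r ^ n" for n
    proof -
      have "u (n mod m) / r ^ (n mod m) \<le> (\<Sum>s<m. u s / r ^ s)"
        using m nonneg \<open>0 < r\<close> by (intro member_le_sum) auto
      then have us: "u (n mod m) \<le> C * r ^ (n mod m)"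
        using \<open>0 < r\<close> by (simp add: C_def field_simps add_increasing)
      have "u n \<le> u m ^ (n div m) * u (n mod m)"
        using submult_div_mod_bound[OF nonneg submult, of "n div m" m "n mod m"] by simp
      also have "\<dots> \<le> (r ^ m) ^ (n div m) * (C * r ^ (n mod m))"
        using um us nonneg \<open>0 < r\<close> by (intro mult_mono power_mono) auto
      also have "\<dots> = C * r ^ (n div m * m + n mod m)"
        by (simp only: power_add power_mult[of r m, symmetric] mult_ac)
      finally show ?thesis
        by simp
    qed
    have "(\<lambda>n. root n C * r) \<longlonglongrightarrow> 1 * r"
      using \<open>1 \<le> C\<close> by (intro tendsto_mult LIMSEQ_root_const tendsto_const) simp
    then have "\<forall>\<^sub>F n in sequentially. root n C * r < y"
      using r(2) by (intro order_tendstoD(2)) simp_all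
    then show ?thesis
      using eventually_gt_at_top[of 0]
    proof eventually_elim
      case (elim n)
      have "root n (u n) \<le> root n (C * r ^ n)"
        using elim bound by simp
      also have "\<dots> = root n C * r"
        using elim \<open>0 < r\<close> by (simp add: real_root_mult real_root_power_cancel)
      finally show ?case
        using elim by simp
    qed
  qed
  have below: "\<forall>\<^sub>F n in sequentially. y < root n (u n)" if "y < L" for y
    using eventually_gt_at_top[of 0]
  proof eventually_elim
    case (elim n)
    then show ?case
      using lower[of n] that by simp
  qed
  show "(\<lambda>n. root n (u n)) \<longlonglongrightarrow> L"
    using below upper by (rule order_tendstoI)
qed

section \<open>Least norms in graded families of functions\<close>

lemma sup_norm_bdd_above:
  assumes "bounded (f ` E)"
  shows "bdd_above (insert 0 ((\<lambda>z. norm (f z)) ` E))"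
  using assms by (auto simp: bounded_iff intro: bdd_aboveI2)

lemma norm_le_sup_norm:
  assumes "bounded (f ` E)" and "z \<in> E"
  shows "norm (f z) \<le> sup_norm E f"
  unfolding sup_norm_def using assms by (intro cSup_upper sup_norm_bdd_above) auto

lemma sup_norm_nonneg:
  assumes "bounded (f ` E)"
  shows "0 \<le> sup_norm E f"
  unfolding sup_norm_def using assms by (intro cSup_upper sup_norm_bdd_above) auto

lemma sup_norm_le:
  assumes "0 \<le> b" and "\<And>z. z \<in> E \<Longrightarrow> norm (f z) \<le> b"
  shows "sup_norm E f \<le> b"
  unfolding sup_norm_def using assms by (intro cSup_least) auto

lemma sup_norm_mult_le:
  assumes "bounded (f ` E)" and "bounded (g ` E)"
  shows "sup_norm E (\<lambda>z. f z * g z) \<le> sup_norm E f * sup_norm E g"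
  using assms
  by (intro sup_norm_le)
    (auto simp: norm_mult intro!: mult_mono mult_nonneg_nonneg norm_le_sup_norm sup_norm_nonneg)

text \<open>
  The infima need not be attained, so the bound is passed to the infimum in one factor at a time,
  dividing by the other factor unless it is 0.
\<close>

lemma le_INF_mult_INF:
  fixes f :: "'a \<Rightarrow> real" and g :: "'b \<Rightarrow> real"
  assumes "A \<noteq> {}" "B \<noteq> {}"
    and f: "\<And>x. x \<in> A \<Longrightarrow> 0 \<le> f x" and g: "\<And>y. y \<in> B \<Longrightarrow> 0 \<le> g y"
    and le: "\<And>x y. x \<in> A \<Longrightarrow> y \<in> B \<Longrightarrow> w \<le> f x * g y"
  shows "w \<le> (INF x\<in>A. f x) * (INF y\<in>B. g y)"
proof -
  \<comment> \<open>One step of this kind; it is applied with a value of \<open>g\<close> as constant factor, then with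
    the infimum of \<open>f\<close>.\<close>
  have div_le: "w \<le> Inf (h ` C) * b"
    if "C \<noteq> {}" "0 \<le> b" "\<And>x. x \<in> C \<Longrightarrow> w \<le> h x * b" for h :: "'c \<Rightarrow> real" and C b
  proof (cases "b = 0")
    case True
    then show ?thesis
      using that by auto
  next
    case False
    then have "w / b \<le> Inf (h ` C)"
      using that by (intro cINF_greatest) (auto simp: field_simps)
    then show ?thesis
      using False that by (simp add: field_simps)
  qed
  have "w \<le> Inf (g ` B) * Inf (f ` A)"
  proof (rule div_le)
    show "0 \<le> Inf (f ` A)"
      using assms by (intro cINF_greatest)
    show "w \<le> g y * Inf (f ` A)" if "y \<in> B" for y
      using div_le[of A "g y" f] assms that by (simp add: mult.commute)
  qed fact
  then show ?thesis
    by (simp add: mult.commute)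
qed

text \<open>
  Both kinds of Chebyshev constants are limits of this form: for \<open>G n\<close> the monic complex
  polynomials of degree exactly \<open>n\<close>, and for \<open>G n\<close> the nonzero integer polynomials of degree
  at most \<open>n\<close>.
\<close>

lemma least_sup_norm_root_tendsto:
  fixes G :: "nat \<Rightarrow> ('a \<Rightarrow> complex) set"
  assumes nonempty: "\<And>n. G n \<noteq> {}"
    and bounded: "\<And>n f. f \<in> G n \<Longrightarrow> bounded (f ` E)"
    and mult: "\<And>m n f g. f \<in> G m \<Longrightarrow> g \<in> G n \<Longrightarrow> (\<lambda>z. f z * g z) \<in> G (m + n)"
  obtains L where "(\<lambda>n. root n (INF f\<in>G n. sup_norm E f)) \<longlonglongrightarrow> L"
    "\<And>n. 0 < n \<Longrightarrow> L \<le> root n (INF f\<in>G n. sup_norm E f)"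
proof (rule submult_root_tendsto[where u = "\<lambda>n. INF f\<in>G n. sup_norm E f"])
  show "0 \<le> (INF f\<in>G n. sup_norm E f)" for n
    using nonempty bounded by (intro cINF_greatest sup_norm_nonneg)
next
  fix m n
  show "(INF f\<in>G (m + n). sup_norm E f) \<le> (INF f\<in>G m. sup_norm E f) * (INF f\<in>G n. sup_norm E f)"
  proof (rule le_INF_mult_INF)
    fix f g
    assume fg: "f \<in> G m" "g \<in> G n"
    have "(INF f\<in>G (m + n). sup_norm E f) \<le> sup_norm E (\<lambda>z. f z * g z)"
      using bounded mult fg by (intro cINF_lower bdd_belowI[of _ 0]) (auto intro: sup_norm_nonneg)
    also have "\<dots> \<le> sup_norm E f * sup_norm E g"
      using bounded fg by (intro sup_norm_mult_le)
    finally show "(INF f\<in>G (m + n). sup_norm E f) \<le> sup_norm E f * sup_norm E g" .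
  qed (use nonempty bounded in \<open>auto intro: sup_norm_nonneg\<close>)
qed (rule that)

section \<open>Leading coefficients on sets of large Chebyshev constant\<close>

text \<open>
  The Chebyshev constant is a lower bound for the \<open>n\<close>-th root of the least norm of monic
  polynomials of degree \<open>n\<close>. Degree 0 is not covered by this, since there is no 0th root; there
  the claim says that \<open>K\<close> is nonempty, which holds because the norm of the identity over the
  empty set would be 0.
\<close>

lemma sup_norm_monic_ge_1:
  assumes K: "compact K" "1 \<le> cheb_const K"
    and p: "lead_coeff p = 1"
  shows "1 \<le> sup_norm K (poly p)"
proof -
  let ?M = "\<lambda>n. {p :: complex poly. degree p = n \<and> lead_coeff p = 1}"
  have bounded: "bounded (poly q ` K)" for q
    using K by (intro compact_imp_bounded compact_continuous_image continuous_intros)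
  obtain L where L: "(\<lambda>n. root n (INF f\<in>poly ` ?M n. sup_norm K f)) \<longlonglongrightarrow> L"
    "\<And>n. 0 < n \<Longrightarrow> L \<le> root n (INF f\<in>poly ` ?M n. sup_norm K f)"
  proof (rule least_sup_norm_root_tendsto[where E = K and G = "\<lambda>n. poly ` ?M n"])
    show "poly ` ?M n \<noteq> {}" for n
      by (auto intro: exI[of _ "monom 1 n"] simp: degree_monom_eq)
  next
    fix m n f g
    assume "f \<in> poly ` ?M m" "g \<in> poly ` ?M n"
    then obtain q r where qr: "q \<in> ?M m" "f = poly q" "r \<in> ?M n" "g = poly r"
      by blast
    then have "q \<noteq> 0" "r \<noteq> 0"
      by auto
    with qr have "q * r \<in> ?M (m + n)"
      using lead_coeff_mult[of q r] by (auto simp: degree_mult_eq)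
    moreover have "(\<lambda>z. f z * g z) = poly (q * r)"
      using qr by (simp add: fun_eq_iff)
    ultimately show "(\<lambda>z. f z * g z) \<in> poly ` ?M (m + n)"
      by blast
  qed (use bounded in auto)
  have "cheb_const K = L"
    using limI[OF L(1)] by (simp add: cheb_const_def image_image)
  have norm_ge: "L ^ n \<le> sup_norm K (poly q)" if "q \<in> ?M n" "0 < n" for q n
  proof -
    have "L ^ n \<le> root n (INF q\<in>?M n. sup_norm K (poly q)) ^ n"
      using L(2)[OF that(2)] K \<open>cheb_const K = L\<close> by (intro power_mono) (auto simp: image_image)
    also have "\<dots> = (INF q\<in>?M n. sup_norm K (poly q))"
      using that by (intro real_root_pow_pos2 cINF_greatest sup_norm_nonneg bounded) auto
    also have "\<dots> \<le> sup_norm K (poly q)"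
      using that by (intro cINF_lower bdd_belowI[of _ 0]) (auto intro!: sup_norm_nonneg bounded)
    finally show ?thesis .
  qed
  show ?thesis
  proof (cases "degree p = 0")
    case True
    then have "p = 1"
      using p by (auto elim!: degree_eq_zeroE simp: one_pCons)
    have "K \<noteq> {}"
    proof
      assume "K = {}"
      then show False
        using norm_ge[of "[:0, 1:]" 1] K \<open>cheb_const K = L\<close> by (simp add: sup_norm_def)
    qed
    then obtain z where "z \<in> K"
      by blast
    then show ?thesis
      using norm_le_sup_norm[OF bounded, of z p] \<open>p = 1\<close> by simp
  next
    case False
    then have "1 \<le> L ^ degree p"
      using K \<open>cheb_const K = L\<close> by (intro one_le_power) simp
    then show ?thesis
      using norm_ge[of p "degree p"] p False by simp
  qed
qed

text \<open>
  Quantifying over all polynomials, without normalisation of the leading coefficient, makes the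
  property directly applicable to a polynomial in one variable whose leading coefficient
  depends on the other variables.
\<close>

definition dominates_lead_coeff :: "complex set \<Rightarrow> bool" where
  "dominates_lead_coeff K \<longleftrightarrow> (\<forall>p. \<exists>w\<in>K. norm (lead_coeff p) \<le> norm (poly p w))"

lemma dominates_lead_coeff_compact:
  assumes K: "compact K" "1 \<le> cheb_const K"
  shows "dominates_lead_coeff K"
  unfolding dominates_lead_coeff_def
proof
  fix p :: "complex poly"
  have "K \<noteq> {}"
    using sup_norm_monic_ge_1[OF K, of 1] by (auto simp: sup_norm_def)
  moreover have "continuous_on K (\<lambda>z. norm (poly p z))"
    by (intro continuous_intros)
  ultimately obtain w where w: "w \<in> K" "\<And>z. z \<in> K \<Longrightarrow> norm (poly p z) \<le> norm (poly p w)"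
    using continuous_attains_sup[OF K(1)] by blast
  have "norm (lead_coeff p) \<le> norm (poly p w)"
  proof (cases "p = 0")
    case False
    define q where "q = smult (inverse (lead_coeff p)) p"
    have "1 \<le> sup_norm K (poly q)"
      using False by (intro sup_norm_monic_ge_1 K) (simp add: q_def)
    also have "\<dots> \<le> norm (poly p w) / norm (lead_coeff p)"
      using w False
      by (intro sup_norm_le) (auto simp: q_def norm_divide inverse_eq_divide divide_right_mono)
    finally show ?thesis
      using False by (simp add: field_simps)
  qed simp
  then show "\<exists>w\<in>K. norm (lead_coeff p) \<le> norm (poly p w)"
    using w(1) by blast
qed

text \<open>
  With the whole plane as each factor, the lower bound for polynomials on products becomes the
  statement that a nonzero polynomial does not vanish identically.
\<close>

lemma dominates_lead_coeff_UNIV: "dominates_lead_coeff UNIV"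
  unfolding dominates_lead_coeff_def
proof
  fix p :: "complex poly"
  show "\<exists>w\<in>UNIV. norm (lead_coeff p) \<le> norm (poly p w)"
  proof (cases p)
    case (pCons a q)
    show ?thesis
    proof (cases "q = 0")
      case True
      then show ?thesis
        using pCons by simp
    next
      case False
      obtain r where "\<And>z. r \<le> norm z \<Longrightarrow> norm (lead_coeff p) \<le> norm (poly (pCons a q) z)"
        using poly_infinity[OF False] by blast
      from this[of "of_real \<bar>r\<bar>"] show ?thesis
        using pCons by (intro bexI[of _ "of_real \<bar>r\<bar>"]) simp_all
    qed
  qed
qed

text \<open>
  Induction over the set \<open>S\<close> of variables. Among the terms, those of maximal degree \<open>m\<close> in the
  new variable \<open>j\<close> form the leading coefficient with respect to that variable. They have the same
  exponent at \<open>j\<close> and hence still distinct exponents on \<open>S\<close>, so a point where this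
  leading coefficient has absolute value at least 1 exists by induction, and the property of
  \<open>F j\<close> yields the value of the new coordinate.
  The terms are indexed by an arbitrary set with exponents \<open>e\<close>, so that the same terms can be
  viewed with fewer and fewer variables without forming polynomials in these variables.
\<close>

lemma exists_norm_ge_1_on_product:
  fixes F :: "'d \<Rightarrow> complex set" and c :: "'k \<Rightarrow> complex" and e :: "'k \<Rightarrow> 'd \<Rightarrow> nat"
  assumes F: "\<And>j. dominates_lead_coeff (F j)"
    and "finite S" and "finite A" and "A \<noteq> {}"
    and "\<And>k. k \<in> A \<Longrightarrow> 1 \<le> norm (c k)"
    and "inj_on (\<lambda>k. restrict (e k) S) A"
  shows "\<exists>z. (\<forall>j. z j \<in> F j) \<and> 1 \<le> norm (\<Sum>k\<in>A. c k * (\<Prod>i\<in>S. z i ^ e k i))"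
  using assms(2-)
proof (induction S arbitrary: A rule: finite_induct)
  case empty
  obtain k where "A = {k}"
    using empty by (auto simp: inj_on_def)
  moreover have "\<exists>w. w \<in> F j" for j
    using F[of j] unfolding dominates_lead_coeff_def by blast
  then have "\<exists>z. \<forall>j. z j \<in> F j"
    by (intro choice) blast
  ultimately show ?case
    using empty.prems by simp
next
  case (insert j S)
  define m where "m = Max ((\<lambda>k. e k j) ` A)"
  define B where "B = {k \<in> A. e k j = m}"
  have "m \<in> (\<lambda>k. e k j) ` A"
    unfolding m_def using insert.prems by (intro Max_in) auto
  then have "B \<noteq> {}"
    by (auto simp: B_def)
  have le_m: "e k j \<le> m" if "k \<in> A" for k
    unfolding m_def using insert.prems that by (intro Max_ge) auto
  have "inj_on (\<lambda>k. restrict (e k) S) B"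
  proof (rule inj_onI)
    fix k l
    assume kl: "k \<in> B" "l \<in> B" "restrict (e k) S = restrict (e l) S"
    have "restrict (e k) (insert j S) = restrict (e l) (insert j S)"
    proof
      fix i
      show "restrict (e k) (insert j S) i = restrict (e l) (insert j S) i"
        using kl(1,2) fun_cong[OF kl(3), of i] by (cases "i \<in> S") (auto simp: B_def)
    qed
    moreover have "k \<in> A" "l \<in> A"
      using kl by (simp_all add: B_def)
    ultimately show "k = l"
      by (rule inj_onD[OF insert.prems(4)])
  qed
  moreover have "finite B" and "\<And>k. k \<in> B \<Longrightarrow> 1 \<le> norm (c k)"
    using insert.prems by (simp_all add: B_def)
  ultimately obtain z where z: "\<And>j. z j \<in> F j"
    and ge_1: "1 \<le> norm (\<Sum>k\<in>B. c k * (\<Prod>i\<in>S. z i ^ e k i))"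
    using insert.IH[of B] \<open>B \<noteq> {}\<close> by blast
  define p where "p = (\<Sum>k\<in>A. monom (c k * (\<Prod>i\<in>S. z i ^ e k i)) (e k j))"
  have coeff_m: "coeff p m = (\<Sum>k\<in>B. c k * (\<Prod>i\<in>S. z i ^ e k i))"
    unfolding p_def B_def coeff_sum coeff_monom
    using insert.prems by (simp add: sum.If_cases Int_def)
  have "degree p \<le> m"
    unfolding p_def using insert.prems
    by (intro degree_sum_le) (auto intro: order_trans[OF degree_monom_le le_m])
  moreover have "coeff p m \<noteq> 0"
    using ge_1 coeff_m by auto
  ultimately have "degree p = m"
    using le_degree by (blast intro: antisym)
  obtain w where w: "w \<in> F j" "norm (lead_coeff p) \<le> norm (poly p w)"
    using F[of j] unfolding dominates_lead_coeff_def by blast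
  have "poly p w = (\<Sum>k\<in>A. c k * (\<Prod>i\<in>insert j S. (z(j := w)) i ^ e k i))"
    unfolding p_def poly_sum
  proof (rule sum.cong[OF refl])
    fix k
    have "(\<Prod>i\<in>S. (z(j := w)) i ^ e k i) = (\<Prod>i\<in>S. z i ^ e k i)"
      using insert.hyps by (intro prod.cong) auto
    then show "poly (monom (c k * (\<Prod>i\<in>S. z i ^ e k i)) (e k j)) w =
        c k * (\<Prod>i\<in>insert j S. (z(j := w)) i ^ e k i)"
      using insert.hyps by (simp add: poly_monom)
  qed
  then show ?case
    using z w ge_1 coeff_m \<open>degree p = m\<close> by (intro exI[of _ "z(j := w)"]) auto
qed

section \<open>Evaluation of integer polynomials\<close>

lemma eval_mpoly_superset:
  assumes "finite A" and "Poly_Mapping.keys P \<subseteq> A"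
  shows "eval_mpoly P z = (\<Sum>k\<in>A. of_int (Poly_Mapping.lookup P k) *
    (\<Prod>i\<in>UNIV. (z $ i) ^ Poly_Mapping.lookup k i))"
  unfolding eval_mpoly_def using assms
  by (intro sum.mono_neutral_left) (auto simp: in_keys_iff)

lemma eval_mpoly_0 [simp]: "eval_mpoly 0 z = 0"
  by (simp add: eval_mpoly_def)

lemma eval_mpoly_single:
  "eval_mpoly (Poly_Mapping.single k a) z =
    of_int a * (\<Prod>i\<in>UNIV. (z $ i) ^ Poly_Mapping.lookup k i)"
  by (subst eval_mpoly_superset[of "{k}"]) auto

lemma eval_mpoly_1 [simp]: "eval_mpoly 1 z = 1"
  using eval_mpoly_single[of 0 1 z] by simp

lemma eval_mpoly_add: "eval_mpoly (P + Q) z = eval_mpoly P z + eval_mpoly Q z"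
  using keys_add[of P Q]
  by (simp add: eval_mpoly_superset[of "Poly_Mapping.keys P \<union> Poly_Mapping.keys Q"]
      lookup_add algebra_simps sum.distrib)

lemma eval_mpoly_sum: "eval_mpoly (\<Sum>x\<in>A. f x) z = (\<Sum>x\<in>A. eval_mpoly (f x) z)"
  by (induction A rule: infinite_finite_induct) (auto simp: eval_mpoly_add)

lemma sum_single_keys: "(\<Sum>k\<in>Poly_Mapping.keys P. Poly_Mapping.single k (Poly_Mapping.lookup P k)) = P"
  by (rule poly_mapping_eqI) (auto simp: lookup_sum lookup_single when_def in_keys_iff)

lemma eval_mpoly_mult: "eval_mpoly (P * Q) z = eval_mpoly P z * eval_mpoly Q z"
proof -
  have "P * Q = (\<Sum>k\<in>Poly_Mapping.keys P. \<Sum>l\<in>Poly_Mapping.keys Q.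
      Poly_Mapping.single (k + l) (Poly_Mapping.lookup P k * Poly_Mapping.lookup Q l))"
    unfolding mult_single[symmetric] sum_product[symmetric] sum_single_keys ..
  then have "eval_mpoly (P * Q) z = (\<Sum>k\<in>Poly_Mapping.keys P. \<Sum>l\<in>Poly_Mapping.keys Q.
      (of_int (Poly_Mapping.lookup P k) * (\<Prod>i\<in>UNIV. (z $ i) ^ Poly_Mapping.lookup k i)) *
      (of_int (Poly_Mapping.lookup Q l) * (\<Prod>i\<in>UNIV. (z $ i) ^ Poly_Mapping.lookup l i)))"
    unfolding \<open>P * Q = _\<close> eval_mpoly_sum eval_mpoly_single
    by (intro sum.cong refl) (simp add: lookup_add power_add prod.distrib)
  then show ?thesis
    by (simp add: eval_mpoly_def sum_product)
qed

text \<open>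
  Integrality enters here and only here: a nonzero integer has absolute value at least 1.
\<close>

lemma exists_norm_eval_mpoly_ge_1:
  assumes "P \<noteq> 0" and F: "\<And>j. dominates_lead_coeff (F j)"
  shows "\<exists>z. (\<forall>j. z $ j \<in> F j) \<and> 1 \<le> norm (eval_mpoly P z)"
proof -
  have "1 \<le> norm (of_int (Poly_Mapping.lookup P k) :: complex)" if "k \<in> Poly_Mapping.keys P" for k
    using that by (simp add: in_keys_iff norm_of_int)
  moreover have "inj_on (\<lambda>k. restrict (Poly_Mapping.lookup k) UNIV) (Poly_Mapping.keys P)"
    by (simp add: inj_on_def restrict_def poly_mapping.lookup_inject)
  ultimately obtain z where "\<And>j. z j \<in> F j"
    "1 \<le> norm (\<Sum>k\<in>Poly_Mapping.keys P. of_int (Poly_Mapping.lookup P k) *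
      (\<Prod>i\<in>UNIV. z i ^ Poly_Mapping.lookup k i) :: complex)"
    using exists_norm_ge_1_on_product[of F UNIV "Poly_Mapping.keys P"
        "\<lambda>k. of_int (Poly_Mapping.lookup P k)" Poly_Mapping.lookup] assms by auto
  then show ?thesis
    by (intro exI[of _ "\<chi> j. z j"]) (simp add: eval_mpoly_def)
qed

lemma exists_eval_mpoly_nonzero:
  assumes "P \<noteq> 0"
  obtains z where "eval_mpoly P z \<noteq> 0"
  using exists_norm_eval_mpoly_ge_1[OF assms, of "\<lambda>_. UNIV"] dominates_lead_coeff_UNIV by fastforce

lemma eval_mpoly_on_line:
  obtains p where "\<And>t. eval_mpoly P (\<chi> i. a $ i + t * (b $ i - a $ i)) = poly p t"
proof
  show "eval_mpoly P (\<chi> i. a $ i + t * (b $ i - a $ i)) =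
    poly (\<Sum>k\<in>Poly_Mapping.keys P. smult (of_int (Poly_Mapping.lookup P k))
      (\<Prod>i\<in>UNIV. [:a $ i, b $ i - a $ i:] ^ Poly_Mapping.lookup k i)) t" for t
    by (simp add: eval_mpoly_def poly_sum poly_prod)
qed

text \<open>
  For a point \<open>a\<close> where \<open>P\<close> does not vanish and a point \<open>b\<close> where \<open>Q\<close> does not vanish, the
  restrictions of \<open>P\<close> and \<open>Q\<close> to the line through \<open>a\<close> and \<open>b\<close> are nonzero polynomials in one
  variable, and their product is nonzero since these form an integral domain.
\<close>

lemma int_mpoly_mult_nonzero:
  fixes P Q :: "('d::finite) int_mpoly"
  assumes "P \<noteq> 0" and "Q \<noteq> 0"
  shows "P * Q \<noteq> 0"
proof -
  obtain a b where ab: "eval_mpoly P a \<noteq> 0" "eval_mpoly Q b \<noteq> 0"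
    using assms exists_eval_mpoly_nonzero by metis
  let ?l = "\<lambda>t. \<chi> i. a $ i + t * (b $ i - a $ i)"
  obtain p where p: "\<And>t. eval_mpoly P (?l t) = poly p t"
    using eval_mpoly_on_line by blast
  obtain q where q: "\<And>t. eval_mpoly Q (?l t) = poly q t"
    using eval_mpoly_on_line by blast
  have "p \<noteq> 0" "q \<noteq> 0"
    using p[of 0] q[of 1] ab by auto
  then have "poly (p * q) \<noteq> poly 0"
    by (simp add: poly_eq_poly_eq_iff del: poly_mult)
  then obtain t where "poly (p * q) t \<noteq> 0"
    by (auto simp: fun_eq_iff)
  then have "eval_mpoly (P * Q) (?l t) \<noteq> 0"
    by (simp add: eval_mpoly_mult p q)
  then show ?thesis
    by auto
qed

section \<open>Integer Chebyshev constants\<close>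

lemma multi_index_size_add: "multi_index_size (k + l) = multi_index_size k + multi_index_size l"
  by (simp add: multi_index_size_def lookup_add sum.distrib)

lemma int_mpolys_mult:
  assumes "P \<in> int_mpolys m" and "Q \<in> int_mpolys n"
  shows "P * Q \<in> int_mpolys (m + n)"
  unfolding int_mpolys_def
proof safe
  fix k
  assume "k \<in> Poly_Mapping.keys (P * Q)"
  then obtain a b where "k = a + b" "a \<in> Poly_Mapping.keys P" "b \<in> Poly_Mapping.keys Q"
    using keys_mult[of P Q] by blast
  then show "multi_index_size k \<le> m + n"
    using assms by (auto simp: int_mpolys_def multi_index_size_add intro: add_mono)
qed

lemma one_in_int_mpolys [simp]: "1 \<in> int_mpolys n"
  by (simp add: int_mpolys_def multi_index_size_def)

lemma bounded_product:
  fixes F :: "'d::finite \<Rightarrow> complex set"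
  assumes "\<And>j. bounded (F j)"
  shows "bounded {z :: complex ^ 'd. \<forall>j. z $ j \<in> F j}"
proof -
  obtain B where B: "\<And>j x. x \<in> F j \<Longrightarrow> norm x \<le> B j"
    using assms unfolding bounded_iff by metis
  have "norm z \<le> (\<Sum>j\<in>UNIV. B j)" if "\<forall>j. z $ j \<in> F j" for z :: "complex ^ 'd"
  proof -
    have "norm z \<le> (\<Sum>j\<in>UNIV. norm (z $ j))"
      unfolding norm_vec_def by (rule L2_set_le_sum) simp
    also have "\<dots> \<le> (\<Sum>j\<in>UNIV. B j)"
      using B that by (intro sum_mono) auto
    finally show ?thesis .
  qed
  then show ?thesis
    unfolding bounded_iff by blast
qed

lemma bounded_eval_mpoly_image:
  assumes "bounded E"
  shows "bounded (eval_mpoly P ` E)"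
proof -
  have "continuous_on (closure E) (eval_mpoly P)"
    unfolding eval_mpoly_def[abs_def] by (intro continuous_intros)
  then have "compact (eval_mpoly P ` closure E)"
    using assms by (intro compact_continuous_image) (simp_all add: compact_closure)
  then show ?thesis
    by (rule bounded_subset[OF compact_imp_bounded]) (use closure_subset in blast)
qed

lemma int_cheb_value_le:
  assumes "bounded E" and "P \<in> int_mpolys n" and "P \<noteq> 0"
  shows "int_cheb_value n E \<le> sup_norm E (eval_mpoly P)"
  unfolding int_cheb_value_def using assms
  by (intro cINF_lower bdd_belowI[of _ 0]) (auto intro!: sup_norm_nonneg bounded_eval_mpoly_image)

lemma int_cheb_value_greatest:
  assumes "\<And>P. P \<in> int_mpolys n \<Longrightarrow> P \<noteq> 0 \<Longrightarrow> b \<le> sup_norm E (eval_mpoly P)"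
  shows "b \<le> int_cheb_value n E"
  unfolding int_cheb_value_def using assms
  by (intro cINF_greatest) (auto intro: exI[of _ 1])

text \<open>
  The constant is defined by \<open>lim\<close>, which says nothing unless the sequence converges.
\<close>

lemma int_cheb_const_tendsto:
  fixes E :: "(complex ^ 'd::finite) set"
  assumes "bounded E"
  shows "(\<lambda>n. root n (int_cheb_value n E)) \<longlonglongrightarrow> int_cheb_const E"
proof -
  let ?G = "\<lambda>n. {P :: 'd int_mpoly. P \<in> int_mpolys n \<and> P \<noteq> 0}"
  obtain L where "(\<lambda>n. root n (INF f\<in>eval_mpoly ` ?G n. sup_norm E f)) \<longlonglongrightarrow> L"
  proof (rule least_sup_norm_root_tendsto[where E = E and G = "\<lambda>n. eval_mpoly ` ?G n"])
    show "eval_mpoly ` ?G n \<noteq> {}" for n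
      unfolding image_is_empty by (auto intro!: exI[of _ 1])
    show "bounded (f ` E)" if "f \<in> eval_mpoly ` ?G n" for f n
      using that bounded_eval_mpoly_image[OF assms] by blast
  next
    fix m n f g
    assume "f \<in> eval_mpoly ` ?G m" "g \<in> eval_mpoly ` ?G n"
    then obtain P Q where PQ: "P \<in> ?G m" "f = eval_mpoly P" "Q \<in> ?G n" "g = eval_mpoly Q"
      by blast
    then have "P * Q \<in> ?G (m + n)"
      by (simp add: int_mpolys_mult int_mpoly_mult_nonzero)
    moreover have "(\<lambda>z. f z * g z) = eval_mpoly (P * Q)"
      using PQ by (simp add: fun_eq_iff eval_mpoly_mult)
    ultimately show "(\<lambda>z. f z * g z) \<in> eval_mpoly ` ?G (m + n)"
      by blast
  qed
  then have "(\<lambda>n. root n (int_cheb_value n E)) \<longlonglongrightarrow> L"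
    by (simp add: int_cheb_value_def image_image)
  then show ?thesis
    unfolding int_cheb_const_def by (simp add: limI)
qed

definition in_variable :: "'d \<Rightarrow> 1 int_mpoly \<Rightarrow> 'd int_mpoly" where
  "in_variable j P = (\<Sum>k\<in>Poly_Mapping.keys P.
    Poly_Mapping.single (Poly_Mapping.single j (Poly_Mapping.lookup k 1)) (Poly_Mapping.lookup P k))"

lemma eval_in_variable: "eval_mpoly (in_variable j P) z = eval_mpoly P (\<chi> _. z $ j)"
proof -
  have "(\<Prod>i\<in>UNIV. (z $ i) ^ Poly_Mapping.lookup (Poly_Mapping.single j n) i) = (z $ j) ^ n" for n
  proof -
    have "(\<Prod>i\<in>UNIV. (z $ i) ^ Poly_Mapping.lookup (Poly_Mapping.single j n) i) =
        (\<Prod>i\<in>{j}. (z $ i) ^ Poly_Mapping.lookup (Poly_Mapping.single j n) i)"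
      by (rule prod.mono_neutral_right) (auto simp: lookup_single)
    then show ?thesis
      by simp
  qed
  then show ?thesis
    by (simp add: in_variable_def eval_mpoly_sum eval_mpoly_single) (simp add: eval_mpoly_def)
qed

text \<open>
  The evaluation of \<open>in_variable j P\<close> on the diagonal is that of \<open>P\<close>, which is not
  identically 0.
\<close>

lemma in_variable_nonzero:
  fixes j :: "'d::finite"
  assumes "P \<noteq> 0"
  shows "in_variable j P \<noteq> 0"
proof -
  obtain z where "eval_mpoly P z \<noteq> 0"
    using assms by (rule exists_eval_mpoly_nonzero)
  moreover have "(\<chi> _. z $ 1) = z"
    by (simp add: vec_eq_iff)
  ultimately have "eval_mpoly (in_variable j P) (\<chi> _. z $ 1) \<noteq> 0"
    by (simp add: eval_in_variable)
  then show ?thesis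
    by auto
qed

lemma in_variable_in_int_mpolys:
  fixes j :: "'d::finite"
  assumes "P \<in> int_mpolys n"
  shows "in_variable j P \<in> int_mpolys n"
  unfolding int_mpolys_def
proof safe
  fix l
  assume "l \<in> Poly_Mapping.keys (in_variable j P)"
  then obtain k where k: "k \<in> Poly_Mapping.keys P" "l = Poly_Mapping.single j (Poly_Mapping.lookup k 1)"
    unfolding in_variable_def
    using keys_sum[of "\<lambda>k. Poly_Mapping.single (Poly_Mapping.single j (Poly_Mapping.lookup k 1))
        (Poly_Mapping.lookup P k)" "Poly_Mapping.keys P"]
    by (auto split: if_splits)
  then have "multi_index_size l = multi_index_size k"
    by (simp add: multi_index_size_def lookup_single when_def)
  then show "multi_index_size l \<le> n"
    using assms k by (simp add: int_mpolys_def)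
qed

lemma int_cheb_const_le_planar:
  fixes F :: "'d::finite \<Rightarrow> complex set"
  assumes F: "\<And>j. bounded (F j)"
  shows "int_cheb_const {z. \<forall>j. z $ j \<in> F j} \<le> int_cheb_const_planar (F j)"
proof -
  let ?E = "{z :: complex ^ 'd. \<forall>j. z $ j \<in> F j}" and ?E1 = "{z :: complex ^ 1. z $ 1 \<in> F j}"
  have E: "bounded ?E" and E1: "bounded ?E1"
    using bounded_product[of F] bounded_product[of "\<lambda>_ :: 1. F j"] F by auto
  have value_le: "int_cheb_value n ?E \<le> int_cheb_value n ?E1" for n
  proof (rule int_cheb_value_greatest)
    fix P :: "1 int_mpoly"
    assume P: "P \<in> int_mpolys n" "P \<noteq> 0"
    have "int_cheb_value n ?E \<le> sup_norm ?E (eval_mpoly (in_variable j P))"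
      using P by (intro int_cheb_value_le E in_variable_in_int_mpolys in_variable_nonzero)
    also have "\<dots> \<le> sup_norm ?E1 (eval_mpoly P)"
    proof (rule sup_norm_le)
      show "0 \<le> sup_norm ?E1 (eval_mpoly P)"
        by (intro sup_norm_nonneg bounded_eval_mpoly_image E1)
      show "norm (eval_mpoly (in_variable j P) z) \<le> sup_norm ?E1 (eval_mpoly P)"
        if "z \<in> ?E" for z
        unfolding eval_in_variable using that
        by (intro norm_le_sup_norm bounded_eval_mpoly_image E1) simp
    qed
    finally show "int_cheb_value n ?E \<le> sup_norm ?E1 (eval_mpoly P)" .
  qed
  show ?thesis
    unfolding int_cheb_const_planar_def
  proof (rule LIMSEQ_le[OF int_cheb_const_tendsto[OF E] int_cheb_const_tendsto[OF E1]])
    show "\<exists>N. \<forall>n\<ge>N. root n (int_cheb_value n ?E) \<le> root n (int_cheb_value n ?E1)"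
      using value_le by (intro exI[of _ 1]) simp
  qed
qed

lemma sup_norm_eval_mpoly_ge_1:
  assumes "bounded {z. \<forall>j. z $ j \<in> F j}" and "P \<noteq> 0" and "\<And>j. dominates_lead_coeff (F j)"
  shows "1 \<le> sup_norm {z. \<forall>j. z $ j \<in> F j} (eval_mpoly P)"
proof -
  obtain z where "\<forall>j. z $ j \<in> F j" "1 \<le> norm (eval_mpoly P z)"
    using exists_norm_eval_mpoly_ge_1 assms by blast
  then show ?thesis
    using norm_le_sup_norm[OF bounded_eval_mpoly_image[OF assms(1)], of z P] by simp
qed

theorem proposition1p3:
  fixes F :: "'d::finite \<Rightarrow> complex set"
    and E :: "(complex ^ 'd) set"
  assumes "\<And>j. compact (F j)"
    and "E = {z. \<forall>j. z $ j \<in> F j}"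
  shows "int_cheb_const E \<le> (MIN j. int_cheb_const_planar (F j)) \<and>
    ((\<forall>j. cheb_const (F j) \<ge> 1) \<longrightarrow>
      (\<forall>n. is_int_cheb_poly n E 1) \<and> int_cheb_const E = 1)"
proof (intro conjI impI)
  have E: "bounded E"
    unfolding assms(2) by (intro bounded_product compact_imp_bounded assms(1))
  show "int_cheb_const E \<le> (MIN j. int_cheb_const_planar (F j))"
    using int_cheb_const_le_planar[of F] assms by (simp add: compact_imp_bounded)
  assume "\<forall>j. cheb_const (F j) \<ge> 1"
  then have dom: "dominates_lead_coeff (F j)" for j
    using assms(1) by (intro dominates_lead_coeff_compact) auto
  have ge_1: "1 \<le> sup_norm E (eval_mpoly P)" if "P \<noteq> 0" for P
    using sup_norm_eval_mpoly_ge_1[of F P] E that dom unfolding assms(2) by blast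
  have "sup_norm E (eval_mpoly 1) = 1"
    by (intro antisym ge_1 sup_norm_le) auto
  then have cheb_value: "int_cheb_value n E = 1" for n
    using int_cheb_value_le[OF E one_in_int_mpolys, of n] ge_1
    by (intro antisym int_cheb_value_greatest) auto
  show "\<forall>n. is_int_cheb_poly n E 1"
    using \<open>sup_norm E (eval_mpoly 1) = 1\<close> by (simp add: is_int_cheb_poly_def cheb_value)
  have "(\<lambda>n. root n (int_cheb_value n E)) \<longlonglongrightarrow> 1"
    unfolding cheb_value by (rule LIMSEQ_root_const) simp
  then show "int_cheb_const E = 1"
    using int_cheb_const_tendsto[OF E] by (rule LIMSEQ_unique[rotated])
qed

end
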